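(* Let $K$ be a field of characteristic zero, let $n\ge 2$, let $K[x]=K[x_1,\dots,x_n]$ be the polynomial algebra, and let $\sigma$ be the $K$-algebra automorphism of $K[x]$ given by $\sigma(x_1)=x_1-1$ and $\sigma(x_i)=x_i+x_{i-1}$ for $2\le i\le n$. Let $m:=[n/2]$. Then the elements $u_0=1$ and $$u_k=x_k^2+\sum_{i=1}^{k-1}\sum_{j=k}^{2k-i}\lambda_{i,j}^k\,x_ix_j+\sum_{i=k}^{2k}\mu_i^k\,x_i,\qquad k=1,\dots,m,$$ where $$\lambda_{i,j}^k=(-1)^{k-i}\left\{\binom{k-i}{j-k}+\binom{k-i-1}{j-k-1}\right\},\qquad \mu_i^k=(-1)^{k-1}\left\{\binom{k}{i-k}+\binom{k-1}{i-k-1}\right\},$$ form a basis of the $K$-vector space $K[x]^\sigma\cap K[x]_{\le 2}$. In particular, $\dim_K(K[x]^\sigma\cap K[x]_{\le 2})=m+1$ and $K[x]^\sigma\cap K[x]_{\le 1}=K$. Each of the coefficients $\lambda_{i,j}^k$ and $\mu_i^k$ (occurring in the formula for $u_k$) is nonzero.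
   Context: $K[x]^\sigma=\{f:\sigma(f)=f\}$. $K[x]_{\le d}$ is the space of polynomials of total degree at most $d$. $[r]$ denotes the integer part (floor) of $r$. Convention: $\binom{a}{b}=0$ for integers $a,b$ not satisfying $0\le b\le a$. *)

theory Defs
  imports Complex_Main "HOL-Library.Poly_Mapping"
begin

text \<open>
  Polynomials in the variables \<open>x\<^sub>0, x\<^sub>1, \<dots>\<close> are finitely supported functions from monomials to
  coefficients, monomials being finitely supported functions from variable indices to exponents.
  The ring structure on this type is the convolution product of the library.
  The algebra \<open>K[x\<^sub>1,\<dots>,x\<^sub>n]\<close> is the carrier \<open>polys n\<close> below.
\<close>

type_synonym 'a mpoly = "(nat \<Rightarrow>\<^sub>0 nat) \<Rightarrow>\<^sub>0 'a"

definition var :: "nat \<Rightarrow> 'a::field mpoly" where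
  "var i = Poly_Mapping.single (Poly_Mapping.single i 1) 1"

definition const :: "'a::field \<Rightarrow> 'a mpoly" where
  "const c = Poly_Mapping.single 0 c"

definition smult :: "'a::field \<Rightarrow> 'a mpoly \<Rightarrow> 'a mpoly" where
  "smult c p = const c * p"

lemma const_simps [simp]:
  "const 0 = 0" "const 1 = 1"
  "const (a + b) = const a + const b" "const (a * b) = const a * const b"
  by (simp_all add: const_def single_add mult_single)

global_interpretation mpoly: vector_space "smult :: 'a::field \<Rightarrow> 'a mpoly \<Rightarrow> 'a mpoly"
  by unfold_locales (simp_all add: smult_def algebra_simps)

definition mon_degree :: "(nat \<Rightarrow>\<^sub>0 nat) \<Rightarrow> nat" where
  "mon_degree m = (\<Sum>i\<in>Poly_Mapping.keys m. Poly_Mapping.lookup m i)"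

definition polys :: "nat \<Rightarrow> 'a::field mpoly set" where
  "polys n = {p. \<forall>m\<in>Poly_Mapping.keys p. Poly_Mapping.keys m \<subseteq> {1..n}}"

definition polys_le :: "nat \<Rightarrow> nat \<Rightarrow> 'a::field mpoly set" where
  "polys_le n d = {p \<in> polys n. \<forall>m\<in>Poly_Mapping.keys p. mon_degree m \<le> d}"

definition algebra_automorphism :: "nat \<Rightarrow> ('a::field mpoly \<Rightarrow> 'a mpoly) \<Rightarrow> bool" where
  "algebra_automorphism n \<sigma> \<longleftrightarrow>
     bij_betw \<sigma> (polys n) (polys n) \<and>
     (\<forall>p\<in>polys n. \<forall>q\<in>polys n. \<sigma> (p + q) = \<sigma> p + \<sigma> q) \<and>
     (\<forall>p\<in>polys n. \<forall>q\<in>polys n. \<sigma> (p * q) = \<sigma> p * \<sigma> q) \<and>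
     (\<forall>c. \<sigma> (const c) = const c)"

definition invariants :: "nat \<Rightarrow> ('a::field mpoly \<Rightarrow> 'a mpoly) \<Rightarrow> 'a mpoly set" where
  "invariants n \<sigma> = {p \<in> polys n. \<sigma> p = p}"

text \<open>Binomial coefficients with integer arguments, zero unless \<open>0 \<le> b \<le> a\<close>.\<close>

definition binom :: "int \<Rightarrow> int \<Rightarrow> int" where
  "binom a b = (if 0 \<le> b \<and> b \<le> a then int (nat a choose nat b) else 0)"

text \<open>
  The coefficients are only used for \<open>1 \<le> i < k\<close> (in \<open>lambda_coeff\<close>) and \<open>1 \<le> k\<close>
  (in \<open>mu_coeff\<close>), so that the natural-number subtractions in the exponents are exact.
\<close>

definition lambda_coeff :: "nat \<Rightarrow> nat \<Rightarrow> nat \<Rightarrow> int" where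
  "lambda_coeff k i j = (-1) ^ (k - i) *
     (binom (int k - int i) (int j - int k) + binom (int k - int i - 1) (int j - int k - 1))"

definition mu_coeff :: "nat \<Rightarrow> nat \<Rightarrow> int" where
  "mu_coeff k i = (-1) ^ (k - 1) *
     (binom (int k) (int i - int k) + binom (int k - 1) (int i - int k - 1))"

definition u :: "nat \<Rightarrow> 'a::field mpoly" where
  "u k = (if k = 0 then 1 else
     var k ^ 2
     + (\<Sum>i=1..k-1. \<Sum>j=k..2*k-i. smult (of_int (lambda_coeff k i j)) (var i * var j))
     + (\<Sum>i=k..2*k. smult (of_int (mu_coeff k i)) (var i)))"

text \<open>
  Existence of the automorphism \<open>\<sigma>\<close>: it is obtained by substitution, with an inverse of the
  same form.
\<close>

definition mon_subst :: "(nat \<Rightarrow> 'a::field mpoly) \<Rightarrow> (nat \<Rightarrow>\<^sub>0 nat) \<Rightarrow> 'a mpoly" where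
  "mon_subst s m = (\<Prod>i\<in>Poly_Mapping.keys m. s i ^ Poly_Mapping.lookup m i)"

definition subst :: "(nat \<Rightarrow> 'a::field mpoly) \<Rightarrow> 'a mpoly \<Rightarrow> 'a mpoly" where
  "subst s p = (\<Sum>m\<in>Poly_Mapping.keys p. const (Poly_Mapping.lookup p m) * mon_subst s m)"

lemma mon_subst_superset:
  assumes "finite A" "Poly_Mapping.keys m \<subseteq> A"
  shows "mon_subst s m = (\<Prod>i\<in>A. s i ^ Poly_Mapping.lookup m i)"
  unfolding mon_subst_def
  by (rule prod.mono_neutral_left) (use assms in \<open>auto simp: in_keys_iff\<close>)

lemma mon_subst_0 [simp]: "mon_subst s 0 = 1"
  by (simp add: mon_subst_def)

lemma mon_subst_add: "mon_subst s (a + b) = mon_subst s a * mon_subst s b"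
proof -
  let ?A = "Poly_Mapping.keys a \<union> Poly_Mapping.keys b"
  have "mon_subst s (a + b) = (\<Prod>i\<in>?A. s i ^ Poly_Mapping.lookup (a + b) i)"
    by (rule mon_subst_superset) (use keys_add[of a b] in auto)
  also have "\<dots> = (\<Prod>i\<in>?A. s i ^ Poly_Mapping.lookup a i) * (\<Prod>i\<in>?A. s i ^ Poly_Mapping.lookup b i)"
    by (simp add: lookup_add power_add prod.distrib)
  also have "\<dots> = mon_subst s a * mon_subst s b"
    by (simp add: mon_subst_superset[of ?A])
  finally show ?thesis .
qed

lemma subst_superset:
  assumes "finite A" "Poly_Mapping.keys p \<subseteq> A"
  shows "subst s p = (\<Sum>m\<in>A. const (Poly_Mapping.lookup p m) * mon_subst s m)"
  unfolding subst_def
  by (rule sum.mono_neutral_left) (use assms in \<open>auto simp: in_keys_iff\<close>)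

lemma subst_add: "subst s (p + q) = subst s p + subst s q"
proof -
  let ?A = "Poly_Mapping.keys p \<union> Poly_Mapping.keys q"
  have "subst s (p + q) = (\<Sum>m\<in>?A. const (Poly_Mapping.lookup (p + q) m) * mon_subst s m)"
    by (rule subst_superset) (use keys_add[of p q] in auto)
  also have "\<dots> = subst s p + subst s q"
    by (simp add: subst_superset[of ?A] lookup_add distrib_right sum.distrib)
  finally show ?thesis .
qed

lemma subst_0 [simp]: "subst s 0 = 0"
  by (simp add: subst_def)

lemma subst_sum: "subst s (sum f A) = (\<Sum>a\<in>A. subst s (f a))"
  by (induction A rule: infinite_finite_induct) (auto simp: subst_add)

lemma subst_single: "subst s (Poly_Mapping.single m c) = const c * mon_subst s m"
  by (subst subst_superset[of "{m}"]) auto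

lemma mpoly_expand:
  fixes p :: "'a::field mpoly"
  shows "p = (\<Sum>m\<in>Poly_Mapping.keys p. Poly_Mapping.single m (Poly_Mapping.lookup p m))"
  by (rule poly_mapping_eqI) (auto simp: lookup_sum lookup_single when_def in_keys_iff)

lemma subst_mult: "subst s (p * q) = subst s p * subst s q"
proof -
  let ?c = "\<lambda>r m. Poly_Mapping.lookup r m"
  have "p * q = (\<Sum>a\<in>Poly_Mapping.keys p. \<Sum>b\<in>Poly_Mapping.keys q.
      Poly_Mapping.single a (?c p a) * Poly_Mapping.single b (?c q b))"
    by (subst mpoly_expand[of p], subst mpoly_expand[of q]) (simp add: sum_product)
  also have "subst s \<dots> = (\<Sum>a\<in>Poly_Mapping.keys p. \<Sum>b\<in>Poly_Mapping.keys q.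
      (const (?c p a) * mon_subst s a) * (const (?c q b) * mon_subst s b))"
    by (simp add: subst_sum mult_single subst_single mon_subst_add mult_ac)
  also have "\<dots> = subst s p * subst s q"
    by (simp add: subst_def sum_product)
  finally show ?thesis .
qed

lemma subst_const [simp]: "subst s (const c) = const c"
  by (simp add: const_def subst_single)

lemma subst_1 [simp]: "subst s 1 = 1"
  using subst_const[of s 1] by simp

lemma subst_var [simp]: "subst s (var i) = s i"
  by (simp add: var_def subst_single mon_subst_def)

lemma subst_minus: "subst s (p - q) = subst s p - subst s q"
  using subst_add[of s "p - q" q] by simp

lemma subst_power: "subst s (p ^ k) = subst s p ^ k"
  by (induction k) (auto simp: subst_mult)

lemma subst_prod: "subst s (prod f A) = (\<Prod>a\<in>A. subst s (f a))"
  by (induction A rule: infinite_finite_induct) (auto simp: subst_mult)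

lemma var_power: "var i ^ k = Poly_Mapping.single (Poly_Mapping.single i k) 1"
proof (induction k)
  case (Suc k)
  then show ?case
    by (simp add: var_def mult_single flip: single_add)
qed simp

lemma mon_subst_var: "mon_subst var m = Poly_Mapping.single m 1"
proof -
  have prod: "(\<Prod>i\<in>A. Poly_Mapping.single (f i) (1::'a)) = Poly_Mapping.single (sum f A) 1"
    for A and f :: "nat \<Rightarrow> nat \<Rightarrow>\<^sub>0 nat"
    by (induction A rule: infinite_finite_induct) (auto simp: mult_single)
  have "m = (\<Sum>i\<in>Poly_Mapping.keys m. Poly_Mapping.single i (Poly_Mapping.lookup m i))"
    by (rule poly_mapping_eqI) (auto simp: lookup_sum lookup_single when_def in_keys_iff)
  then show ?thesis
    by (simp add: mon_subst_def var_power prod)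
qed

lemma subst_var_id: "subst var p = p"
  by (subst (2) mpoly_expand[of p])
     (simp add: subst_def mon_subst_var const_def mult_single)

lemma subst_subst: "subst s (subst t p) = subst (\<lambda>i. subst s (t i)) p"
  by (simp add: subst_def[of t] subst_def[of "\<lambda>i. subst s (t i)"] subst_sum subst_mult
      mon_subst_def subst_prod subst_power)

lemma polys_closed:
  "p \<in> polys n \<Longrightarrow> q \<in> polys n \<Longrightarrow> p + q \<in> polys n"
  "p \<in> polys n \<Longrightarrow> q \<in> polys n \<Longrightarrow> p - q \<in> polys n"
  "p \<in> polys n \<Longrightarrow> q \<in> polys n \<Longrightarrow> p * q \<in> polys n"
  "const c \<in> polys n" "1 \<in> polys n" "0 \<in> polys n"
  "1 \<le> i \<Longrightarrow> i \<le> n \<Longrightarrow> var i \<in> polys n"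
proof -
  show "p + q \<in> polys n" if "p \<in> polys n" "q \<in> polys n"
    using that keys_add[of p q] unfolding polys_def by blast
  show "p - q \<in> polys n" if "p \<in> polys n" "q \<in> polys n"
    proof -
    have "m \<in> Poly_Mapping.keys p \<or> m \<in> Poly_Mapping.keys q" if "m \<in> Poly_Mapping.keys (p - q)" for m
      using that by (auto simp: in_keys_iff lookup_minus)
    then show ?thesis using that unfolding polys_def by blast
  qed
  show "p * q \<in> polys n" if "p \<in> polys n" "q \<in> polys n"
  proof -
    have "Poly_Mapping.keys m \<subseteq> {1..n}" if m: "m \<in> Poly_Mapping.keys (p * q)" for m
    proof -
      obtain a b where "m = a + b" "a \<in> Poly_Mapping.keys p" "b \<in> Poly_Mapping.keys q"
        using m keys_mult[of p q] by blast
      then show ?thesis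
        using \<open>p \<in> polys n\<close> \<open>q \<in> polys n\<close> keys_add[of a b] unfolding polys_def by blast
    qed
    then show ?thesis by (simp add: polys_def)
  qed
qed (auto simp: polys_def const_def var_def)

lemma subst_polys:
  assumes s: "\<And>i. 1 \<le> i \<Longrightarrow> i \<le> n \<Longrightarrow> s i \<in> polys n" and p: "p \<in> polys n"
  shows "subst s p \<in> polys n"
proof -
  have sum: "sum f A \<in> polys n" if "\<And>a. a \<in> A \<Longrightarrow> f a \<in> polys n"
    for A and f :: "(nat \<Rightarrow>\<^sub>0 nat) \<Rightarrow> 'a mpoly"
    using that by (induction A rule: infinite_finite_induct) (auto intro: polys_closed)
  have prod: "prod f A \<in> polys n" if "\<And>a. a \<in> A \<Longrightarrow> f a \<in> polys n"
    for A and f :: "nat \<Rightarrow> 'a mpoly"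
    using that by (induction A rule: infinite_finite_induct) (auto intro: polys_closed)
  have pow: "q ^ k \<in> polys n" if "q \<in> polys n" for q :: "'a mpoly" and k
    using that by (induction k) (auto intro: polys_closed)
  show ?thesis
    unfolding subst_def mon_subst_def
  proof (intro sum polys_closed(3,4) prod pow s)
    fix m i assume "m \<in> Poly_Mapping.keys p" "i \<in> Poly_Mapping.keys m"
    then have "i \<in> {1..n}" using p unfolding polys_def by blast
    then show "1 \<le> i" "i \<le> n" by auto
  qed
qed

fun shift_var :: "nat \<Rightarrow> 'a::field mpoly" where
  "shift_var 0 = var 0"
| "shift_var (Suc 0) = var 1 - 1"
| "shift_var (Suc (Suc i)) = var (Suc (Suc i)) + var (Suc i)"

fun unshift_var :: "nat \<Rightarrow> 'a::field mpoly" where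
  "unshift_var 0 = var 0"
| "unshift_var (Suc 0) = var 1 + 1"
| "unshift_var (Suc (Suc i)) = var (Suc (Suc i)) - unshift_var (Suc i)"

proposition automorphism_exists:
  "\<exists>\<sigma>::'a::field mpoly \<Rightarrow> 'a mpoly. algebra_automorphism n \<sigma> \<and>
     \<sigma> (var 1) = var 1 - 1 \<and> (\<forall>i\<in>{2..n}. \<sigma> (var i) = var i + var (i - 1))"
proof (intro exI conjI ballI)
  let ?s = "subst shift_var :: 'a mpoly \<Rightarrow> 'a mpoly"
  let ?t = "subst unshift_var :: 'a mpoly \<Rightarrow> 'a mpoly"
  have "?s (unshift_var i) = var i" for i
    by (induction i rule: unshift_var.induct) (auto simp: subst_add subst_minus)
  then have st: "?s (?t p) = p" for p
    by (simp add: subst_subst subst_var_id)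
  have "?t (shift_var i) = var i" for i
    by (induction i rule: shift_var.induct) (auto simp: subst_add subst_minus)
  then have ts: "?t (?s p) = p" for p
    by (simp add: subst_subst subst_var_id)
  have s: "shift_var i \<in> (polys n :: 'a mpoly set)" if "1 \<le> i" "i \<le> n" for i
    using that by (induction i rule: shift_var.induct) (auto intro!: polys_closed)
  have t: "unshift_var i \<in> (polys n :: 'a mpoly set)" if "1 \<le> i" "i \<le> n" for i
    using that by (induction i rule: unshift_var.induct) (auto intro!: polys_closed)
  have "bij_betw ?s (polys n) (polys n)"
    by (rule bij_betw_byWitness[where f' = ?t]) (auto simp: st ts intro: subst_polys s t)
  then show "algebra_automorphism n ?s"
    by (simp add: algebra_automorphism_def subst_add subst_mult)
  show "?s (var 1) = var 1 - 1"
    by simp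
  show "?s (var i) = var i + var (i - 1)" if "i \<in> {2..n}" for i
    using that by (cases i rule: shift_var.cases) auto
qed

end

theory Submission
  imports Defs
begin

text \<open>
  Put \<open>x\<^sub>0 = -1\<close>; then \<open>\<sigma>(x\<^sub>i) = x\<^sub>i + x\<^bsub>i-1\<^esub>\<close> for all \<open>i \<ge> 1\<close> and \<open>\<sigma>(x\<^sub>0) = x\<^sub>0\<close>, and the polynomials of
  degree at most \<open>2\<close> are the quadratic forms \<open>\<Sum> a\<^sub>i\<^sub>j x\<^sub>i x\<^sub>j\<close> in \<open>x\<^sub>0, \<dots>, x\<^sub>n\<close> with \<open>a\<close> symmetric.
  Invariance means \<open>a(i, j+1) + a(i+1, j) + a(i+1, j+1) = 0\<close>, with entries outside the range
  set to zero.  On the largest antidiagonal \<open>i + j = s\<close> on which \<open>a\<close> does not vanish, this says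
  that the entries are equal up to alternating signs.  By symmetry they vanish if \<open>s\<close> is odd, and
  they are determined by the entry \<open>a(s/2, s/2)\<close> if \<open>s\<close> is even; they vanish if \<open>s > n\<close>.  Hence
  the diagonal entries \<open>a(k, k)\<close> with \<open>2k \<le> n\<close> determine an invariant.  The \<open>u\<^sub>k\<close> satisfy the
  recurrence by Pascal's rule, and their diagonals are the unit vectors.
\<close>

section \<open>Quadratic forms in \<open>x\<^sub>0, \<dots>, x\<^sub>n\<close> with \<open>x\<^sub>0 = -1\<close>\<close>

definition hvar :: "nat \<Rightarrow> 'a::field mpoly" where
  "hvar i = (if i = 0 then - 1 else var i)"

text \<open>Index 0 gives the empty monomial, so the sums \<open>hmon i + hmon j\<close> over
  indices up to \<open>n\<close> are exactly the monomials of degree at most 2. The scalar -1 of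
  \<open>hvar 0\<close> is kept apart in \<open>hsign\<close>.\<close>

definition hmon :: "nat \<Rightarrow> (nat \<Rightarrow>\<^sub>0 nat)" where
  "hmon i = (if i = 0 then 0 else Poly_Mapping.single i 1)"

definition hsign :: "nat \<Rightarrow> 'a::field" where
  "hsign i = (if i = 0 then - 1 else 1)"

definition qform :: "nat \<Rightarrow> (nat \<Rightarrow> nat \<Rightarrow> 'a::field) \<Rightarrow> 'a mpoly" where
  "qform n a = (\<Sum>i\<le>n. \<Sum>j\<le>n. smult (a i j) (hvar i * hvar j))"

text \<open>In characteristic zero this inverts \<open>qform\<close> on symmetric matrices: the
  positions \<open>(i, j)\<close> and \<open>(j, i)\<close> feed the same monomial, hence the 2, and
  the signs cancel when multiplied in again.\<close>

definition qcoef :: "'a::field mpoly \<Rightarrow> nat \<Rightarrow> nat \<Rightarrow> 'a" where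
  "qcoef p i j = hsign i * hsign j * Poly_Mapping.lookup p (hmon i + hmon j) / (if i = j then 1 else 2)"

lemma hsign_square [simp]: "hsign i * hsign i = 1" "hsign i * (hsign i * x) = x"
  by (simp_all add: hsign_def)

lemma hsign_nonzero [simp]: "hsign i \<noteq> 0"
  by (simp add: hsign_def)

lemma hvar_eq_single: "hvar i = Poly_Mapping.single (hmon i) (hsign i)"
  by (simp add: hvar_def hmon_def hsign_def var_def single_uminus)

lemma lookup_hmon: "Poly_Mapping.lookup (hmon i) r = (if r = i \<and> i \<noteq> 0 then 1 else 0)"
  by (auto simp: hmon_def lookup_single when_def)

lemma hmon_add_eq_iff:
  "hmon i + hmon j = hmon k + hmon l \<longleftrightarrow> (i = k \<and> j = l) \<or> (i = l \<and> j = k)"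
proof
  assume "hmon i + hmon j = hmon k + hmon l"
  then have "Poly_Mapping.lookup (hmon i) r + Poly_Mapping.lookup (hmon j) r =
      Poly_Mapping.lookup (hmon k) r + Poly_Mapping.lookup (hmon l) r" for r
    by (metis lookup_add)
  \<comment> \<open>The exponents at these four indices already determine the unordered pair; index
    0 is visible only as a missing factor.\<close>
  from this[of i] this[of j] this[of k] this[of l]
  show "(i = k \<and> j = l) \<or> (i = l \<and> j = k)"
    by (simp add: lookup_hmon split: if_splits)
qed (auto simp: add.commute)

lemma lookup_eq_qcoef:
  fixes p :: "'a::field_char_0 mpoly"
  shows "Poly_Mapping.lookup p (hmon i + hmon j) =
    hsign i * hsign j * (if i = j then 1 else 2) * qcoef p i j"
  by (simp add: qcoef_def mult_ac)

lemma qcoef_sym: "qcoef p i j = qcoef p j i"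
  by (simp add: qcoef_def mult_ac add.commute)

lemma qcoef_0 [simp]: "qcoef 0 i j = 0"
  by (simp add: qcoef_def)

lemma qcoef_add: "qcoef (p + q) i j = qcoef p i j + qcoef q i j"
  by (simp add: qcoef_def lookup_add algebra_simps add_divide_distrib)

lemma smult_single: "smult c (Poly_Mapping.single m d) = Poly_Mapping.single m (c * d)"
  by (simp add: smult_def const_def mult_single)

lemma lookup_smult: "Poly_Mapping.lookup (smult c p) m = c * Poly_Mapping.lookup p m"
proof -
  have "smult c p = (\<Sum>r\<in>Poly_Mapping.keys p.
      Poly_Mapping.single r (c * Poly_Mapping.lookup p r))"
    by (subst mpoly_expand[of p]) (simp add: mpoly.scale_sum_right smult_single)
  then show ?thesis
    by (auto simp: lookup_sum lookup_single when_def in_keys_iff)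
qed

lemma qcoef_smult: "qcoef (smult c p) i j = c * qcoef p i j"
  by (simp add: qcoef_def lookup_smult)

lemma qcoef_sum: "qcoef (sum f A) i j = (\<Sum>x\<in>A. qcoef (f x) i j)"
  by (induction A rule: infinite_finite_induct) (auto simp: qcoef_add)

lemma lookup_qform:
  "Poly_Mapping.lookup (qform n a) m =
    (\<Sum>i\<le>n. \<Sum>j\<le>n. if hmon i + hmon j = m then a i j * (hsign i * hsign j) else 0)"
  by (simp add: qform_def lookup_sum hvar_eq_single mult_single smult_single lookup_single when_def)

lemma qcoef_qform:
  fixes a :: "nat \<Rightarrow> nat \<Rightarrow> 'a::field_char_0"
  assumes sym: "\<And>i j. a i j = a j i" and "i \<le> n" "j \<le> n"
  shows "qcoef (qform n a) i j = a i j"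
proof -
  let ?g = "\<lambda>k l. a k l * (hsign k * hsign l)"
  have delta: "(\<Sum>k\<le>n. \<Sum>l\<le>n. if k = x \<and> l = y then ?g k l else 0) = ?g x y"
    if "x \<le> n" "y \<le> n" for x y
  proof -
    have "(\<Sum>k\<le>n. \<Sum>l\<le>n. if k = x \<and> l = y then ?g k l else 0) =
        (\<Sum>k\<le>n. if k = x then (\<Sum>l\<le>n. if l = y then ?g x l else 0) else 0)"
      by (intro sum.cong) auto
    then show ?thesis
      using that by simp
  qed
  \<comment> \<open>Exactly the ordered pairs \<open>(i, j)\<close> and \<open>(j, i)\<close>
    produce this monomial; the second summand is suppressed when they coincide.\<close>
  have "Poly_Mapping.lookup (qform n a) (hmon i + hmon j) =
      (\<Sum>k\<le>n. \<Sum>l\<le>n. (if k = i \<and> l = j then ?g k l else 0) +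
        (if i = j then 0 else if k = j \<and> l = i then ?g k l else 0))"
    unfolding lookup_qform hmon_add_eq_iff by (intro sum.cong) auto
  also have "\<dots> = (if i = j then 1 else 2) * ?g i j"
    using assms(2,3) delta[of i j] delta[of j i] sym[of i j] by (simp add: sum.distrib mult_ac)
  finally show ?thesis
    by (auto simp: qcoef_def mult_ac)
qed

section \<open>Monomials of degree at most two and the reconstruction of a polynomial from its
  matrix\<close>

lemma mon_degree_superset:
  assumes "finite A" "Poly_Mapping.keys m \<subseteq> A"
  shows "mon_degree m = (\<Sum>i\<in>A. Poly_Mapping.lookup m i)"
  unfolding mon_degree_def
  by (rule sum.mono_neutral_left) (use assms in \<open>auto simp: in_keys_iff\<close>)

lemma mon_degree_add: "mon_degree (a + b) = mon_degree a + mon_degree b"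
proof -
  let ?A = "Poly_Mapping.keys a \<union> Poly_Mapping.keys b"
  have "mon_degree (a + b) = (\<Sum>i\<in>?A. Poly_Mapping.lookup (a + b) i)"
    by (rule mon_degree_superset) (use keys_add[of a b] in auto)
  then show ?thesis
    by (simp add: lookup_add sum.distrib mon_degree_superset[of ?A])
qed

lemma mon_degree_hmon: "mon_degree (hmon i) = (if i = 0 then 0 else 1)"
  by (simp add: hmon_def mon_degree_def)

lemma keys_hmon_add: "Poly_Mapping.keys (hmon i + hmon j) = {i, j} - {0}"
  by (auto simp: in_keys_iff lookup_add lookup_hmon split: if_splits)

lemma mon_split:
  assumes "m \<noteq> 0" "Poly_Mapping.keys m \<subseteq> {1..n}"
  obtains i r where "1 \<le> i" "i \<le> n" "m = r + hmon i"
    "Poly_Mapping.keys r \<subseteq> {1..n}" "mon_degree m = Suc (mon_degree r)"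
proof -
  obtain i where i: "i \<in> Poly_Mapping.keys m"
    using assms(1) by (metis ex_in_conv keys_eq_empty)
  then have "1 \<le> i" "i \<le> n"
    using assms(2) by auto
  have m: "m = (m - hmon i) + hmon i"
    using i \<open>1 \<le> i\<close>
    by (intro poly_mapping_eqI) (auto simp: lookup_add lookup_minus lookup_hmon in_keys_iff)
  have "Poly_Mapping.keys (m - hmon i) \<subseteq> {1..n}"
  proof -
    have "Poly_Mapping.keys (m - hmon i) \<subseteq> Poly_Mapping.keys m"
      by (auto simp: in_keys_iff lookup_minus)
    with assms(2) show ?thesis by blast
  qed
  moreover have "mon_degree m = Suc (mon_degree (m - hmon i))"
    using \<open>1 \<le> i\<close> by (subst m) (simp add: mon_degree_add mon_degree_hmon)
  ultimately show ?thesis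
    using that \<open>1 \<le> i\<close> \<open>i \<le> n\<close> m by blast
qed

text \<open>Variables are peeled off one at a time, at most twice; a missing factor is filled with
  index 0, since \<open>hmon 0 = 0\<close>.\<close>

lemma mon_degree_le_2E:
  assumes "Poly_Mapping.keys m \<subseteq> {1..n}" "mon_degree m \<le> 2"
  obtains i j where "i \<le> n" "j \<le> n" "m = hmon i + hmon j"
proof (cases "m = 0")
  case True
  then show ?thesis using that[of 0 0] by (simp add: hmon_def)
next
  case False
  then obtain i r where r: "i \<le> n" "m = r + hmon i" "Poly_Mapping.keys r \<subseteq> {1..n}"
      "mon_degree m = Suc (mon_degree r)"
    using mon_split assms(1) by metis
  show ?thesis
  proof (cases "r = 0")
    case True
    then show ?thesis using that[of 0 i] r by (simp add: hmon_def)
  next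
    case False
    then obtain j t where t: "j \<le> n" "r = t + hmon j" "Poly_Mapping.keys t \<subseteq> {1..n}"
        "mon_degree r = Suc (mon_degree t)"
      using mon_split r(3) by metis
    have "t = 0"
    proof (rule ccontr)
      assume "t \<noteq> 0"
      then obtain s where "mon_degree t = Suc (mon_degree s)"
        using mon_split t(3) by metis
      then show False
        using assms(2) r(4) t(4) by simp
    qed
    then show ?thesis
      using that[of j i] r t by simp
  qed
qed

lemma qform_qcoef:
  fixes p :: "'a::field_char_0 mpoly"
  assumes p: "p \<in> polys_le n 2"
  shows "qform n (qcoef p) = p"
proof (rule poly_mapping_eqI)
  fix m
  show "Poly_Mapping.lookup (qform n (qcoef p)) m = Poly_Mapping.lookup p m"
  proof (cases "\<exists>i\<le>n. \<exists>j\<le>n. m = hmon i + hmon j")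
    case True
    then obtain i j where "i \<le> n" "j \<le> n" "m = hmon i + hmon j"
      by blast
    then show ?thesis
      by (simp add: lookup_eq_qcoef qcoef_qform[OF qcoef_sym])
  next
    case False
    then have "m \<notin> Poly_Mapping.keys p"
      using p mon_degree_le_2E[of m n] unfolding polys_le_def polys_def by blast
    moreover have "Poly_Mapping.lookup (qform n (qcoef p)) m = 0"
      unfolding lookup_qform using False by (intro sum.neutral ballI) auto
    ultimately show ?thesis
      by (simp add: in_keys_iff)
  qed
qed

lemma qcoef_outside:
  assumes "p \<in> polys n" "n < i"
  shows "qcoef p i j = 0"
proof -
  have "i \<in> Poly_Mapping.keys (hmon i + hmon j)" "i \<notin> {1..n}"
    using assms(2) by (auto simp: keys_hmon_add)
  then have "hmon i + hmon j \<notin> Poly_Mapping.keys p"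
    using assms(1) unfolding polys_def by blast
  then show ?thesis
    by (simp add: qcoef_def in_keys_iff)
qed

lemma hvar_polys: "i \<le> n \<Longrightarrow> hvar i \<in> polys n"
  by (auto simp: hvar_eq_single hmon_def polys_def split: if_splits)

lemma smult_polys: "p \<in> polys n \<Longrightarrow> smult c p \<in> polys n"
  unfolding smult_def by (intro polys_closed)

lemma sum_polys: "(\<And>x. x \<in> A \<Longrightarrow> f x \<in> polys n) \<Longrightarrow> sum f A \<in> polys n"
  by (induction A rule: infinite_finite_induct) (auto intro: polys_closed)

lemma qform_polys_le: "qform n a \<in> polys_le n 2"
proof -
  have "qform n a \<in> polys n"
    unfolding qform_def by (intro sum_polys smult_polys polys_closed hvar_polys) auto
  moreover have "mon_degree m \<le> 2" if m: "m \<in> Poly_Mapping.keys (qform n a)" for m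
  proof (rule ccontr)
    assume "\<not> mon_degree m \<le> 2"
    then have "hmon i + hmon j \<noteq> m" for i j
      by (auto simp: mon_degree_add mon_degree_hmon split: if_splits)
    then have "Poly_Mapping.lookup (qform n a) m = 0"
      by (simp add: lookup_qform)
    then show False
      using m by (simp add: in_keys_iff)
  qed
  ultimately show ?thesis
    by (simp add: polys_le_def)
qed

section \<open>The action on quadratic forms\<close>

text \<open>Summation by parts: the shift is moved from the variables to the coefficients. The
  boundary condition lets the reindexed sum, which ends at \<open>n - 1\<close>, be extended to
  \<open>n\<close>.\<close>

lemma sum_shift_hvar:
  fixes f :: "nat \<Rightarrow> 'a::field mpoly"
  assumes "f (Suc n) = 0"
  shows "(\<Sum>i\<le>n. f i * (hvar i + (if i = 0 then 0 else hvar (i - 1)))) =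
    (\<Sum>i\<le>n. (f i + f (Suc i)) * hvar i)"
proof -
  have "(\<Sum>i\<le>n. f i * (if i = 0 then 0 else hvar (i - 1))) = (\<Sum>i<n. f (Suc i) * hvar i)"
    by (simp add: lessThan_Suc_atMost[symmetric] sum.lessThan_Suc_shift del: sum.lessThan_Suc)
  also have "\<dots> = (\<Sum>i\<le>n. f (Suc i) * hvar i)"
    using assms by (simp add: lessThan_Suc_atMost[symmetric])
  finally show ?thesis
    by (simp add: distrib_left distrib_right sum.distrib)
qed

lemma automorphism_sum:
  assumes "algebra_automorphism n \<sigma>" "\<And>x. x \<in> A \<Longrightarrow> f x \<in> polys n"
  shows "\<sigma> (sum f A) = (\<Sum>x\<in>A. \<sigma> (f x))"
proof -
  have "\<sigma> 0 = 0"
    using assms(1) unfolding algebra_automorphism_def by (metis const_simps(1))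
  show ?thesis
    using assms(2)
  proof (induction A rule: infinite_finite_induct)
    case (insert x F)
    then have "sum f F \<in> polys n" "f x \<in> polys n"
      by (auto intro: sum_polys)
    then have "\<sigma> (f x + sum f F) = \<sigma> (f x) + \<sigma> (sum f F)"
      using assms(1) by (simp add: algebra_automorphism_def)
    with insert show ?case by simp
  qed (auto simp: \<open>\<sigma> 0 = 0\<close>)
qed

lemma automorphism_qform:
  fixes \<sigma> :: "'a::field mpoly \<Rightarrow> 'a mpoly"
  assumes \<sigma>: "algebra_automorphism n \<sigma>"
    and \<sigma>1: "\<sigma> (var 1) = var 1 - 1"
    and \<sigma>i: "\<forall>i\<in>{2..n}. \<sigma> (var i) = var i + var (i - 1)"
    and a0: "\<And>i j. n < i \<or> n < j \<Longrightarrow> a i j = 0"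
  shows "\<sigma> (qform n a) =
    qform n (\<lambda>i j. a i j + a (Suc i) j + a i (Suc j) + a (Suc i) (Suc j))"
proof -
  let ?Y = "\<lambda>i. hvar i + (if i = 0 then 0 else hvar (i - 1)) :: 'a mpoly"
  have mult: "\<sigma> (p * q) = \<sigma> p * \<sigma> q" if "p \<in> polys n" "q \<in> polys n" for p q
    using \<sigma> that by (simp add: algebra_automorphism_def)
  have c: "\<sigma> (const c) = const c" for c
    using \<sigma> by (simp add: algebra_automorphism_def)
  have Y: "\<sigma> (hvar i) = ?Y i" if "i \<le> n" for i
  proof -
    consider "i = 0" | "i = 1" | "2 \<le> i" by linarith
    then show ?thesis
    proof cases
      case 1
      \<comment> \<open>As a scalar, \<open>hvar 0\<close> is fixed by the automorphism, which
        matches the zero shift at index 0.\<close>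
      have "hvar 0 = const (- 1 :: 'a)"
        by (simp add: hvar_def const_def single_uminus)
      with 1 show ?thesis
        by (simp add: c)
    next
      case 2
      then show ?thesis using \<sigma>1 by (simp add: hvar_def)
    next
      case 3
      then show ?thesis using \<sigma>i that by (simp add: hvar_def)
    qed
  qed
  have polys: "smult (a i j) (hvar i * hvar j) \<in> polys n" if "i \<le> n" "j \<le> n" for i j
    using that by (intro smult_polys polys_closed hvar_polys)
  then have "\<sigma> (\<Sum>j\<le>n. smult (a i j) (hvar i * hvar j)) =
      (\<Sum>j\<le>n. \<sigma> (smult (a i j) (hvar i * hvar j)))" if "i \<le> n" for i
    using that by (intro automorphism_sum[OF \<sigma>]) auto
  then have "\<sigma> (qform n a) = (\<Sum>i\<le>n. \<Sum>j\<le>n. \<sigma> (smult (a i j) (hvar i * hvar j)))"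
    unfolding qform_def using polys by (subst automorphism_sum[OF \<sigma>]) (auto intro: sum_polys)
  also have "\<dots> = (\<Sum>i\<le>n. \<Sum>j\<le>n. const (a i j) * (?Y i * ?Y j))"
    by (intro sum.cong refl) (simp add: smult_def mult polys_closed hvar_polys c Y)
  also have "\<dots> = (\<Sum>i\<le>n. (\<Sum>j\<le>n. const (a i j) * ?Y j) * ?Y i)"
    by (simp only: sum_distrib_left sum_distrib_right mult_ac)
  \<comment> \<open>The shift is moved to the coefficients one index at a time, first in
    \<open>j\<close>.\<close>
  also have "\<dots> = (\<Sum>i\<le>n. (\<Sum>j\<le>n. (const (a i j) + const (a i (Suc j))) * hvar j) * ?Y i)"
    by (intro sum.cong refl arg_cong2[where f = "(*)"] sum_shift_hvar) (simp add: a0)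
  \<comment> \<open>For the shift in \<open>i\<close> the coefficients are the whole inner sums;
    this is why \<open>sum_shift_hvar\<close> admits polynomial coefficients.\<close>
  also have "\<dots> = (\<Sum>i\<le>n. ((\<Sum>j\<le>n. (const (a i j) + const (a i (Suc j))) * hvar j) +
      (\<Sum>j\<le>n. (const (a (Suc i) j) + const (a (Suc i) (Suc j))) * hvar j)) * hvar i)"
    by (rule sum_shift_hvar) (simp add: a0)
  also have "\<dots> = qform n (\<lambda>i j. a i j + a (Suc i) j + a i (Suc j) + a (Suc i) (Suc j))"
    unfolding qform_def
    by (simp add: smult_def sum_distrib_right sum_distrib_left sum.distrib algebra_simps)
  finally show ?thesis .
qed

section \<open>Uniqueness: an invariant is determined by its diagonal\<close>

lemma antidiagonal_recurrence_zero:
  fixes a :: "nat \<Rightarrow> nat \<Rightarrow> 'a::field_char_0"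
  assumes sym: "\<And>i j. a i j = a j i"
    and out: "\<And>i j. n < i \<Longrightarrow> a i j = 0"
    and rec: "\<And>i j. a i (Suc j) + a (Suc i) j + a (Suc i) (Suc j) = 0"
    and diag: "\<And>k. 2 * k \<le> n \<Longrightarrow> a k k = 0"
  shows "a i j = 0"
proof -
  have top: "a i j = 0" if "i + j > 2 * n" for i j
    using that out[of i j] out[of j i] sym[of i j] by (cases "n < i") auto
  \<comment> \<open>Descending induction on the antidiagonal \<open>s\<close>; it starts at
    \<open>Suc (2 * n)\<close>, where one of the indices must exceed \<open>n\<close>.\<close>
  have "\<forall>i j. i + j \<ge> s \<longrightarrow> a i j = 0" if "s \<le> Suc (2 * n)" for s
    using that
  proof (induction s rule: inc_induct)
    case base
    then show ?case using top by auto
  next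
    case (step s)
    \<comment> \<open>In the recurrence at \<open>(i, s - Suc i)\<close> the third entry lies on
      antidiagonal \<open>s + 1\<close>, where \<open>a\<close> is already zero, so neighbouring
      entries are opposite.\<close>
    have alt: "i \<le> s \<Longrightarrow> a i (s - i) = (- 1) ^ i * a 0 s" for i
    proof (induction i)
      case (Suc i)
      then have "a (Suc i) (Suc (s - Suc i)) = 0"
        using step.IH by auto
      with rec[of i "s - Suc i"] Suc show ?case
        by (simp add: Suc_diff_Suc eq_neg_iff_add_eq_0 add.commute)
    qed simp
    have "a 0 s = 0"
    proof (cases "even s")
      case True
      then obtain k where k: "s = 2 * k" by blast
      show ?thesis
      proof (cases "2 * k \<le> n")
        case True
        then show ?thesis using alt[of k] diag[of k] k by simp
      next
        case False
        then show ?thesis using k out[of s 0] sym[of s 0] by simp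
      qed
    next
      case False
      \<comment> \<open>Walking the whole antidiagonal from \<open>(0, s)\<close> to
        \<open>(s, 0)\<close> takes an odd number of sign changes, while symmetry identifies its
        ends.\<close>
      then have "a 0 s = - a 0 s"
        using alt[of s] sym[of s 0] by simp
      then show ?thesis by simp
    qed
    then have "a i j = 0" if "i + j = s" for i j
      using alt[of i] that by auto
    then show ?case
      using step.IH by (metis Suc_leI le_neq_implies_less)
  qed
  from this[of 0] show ?thesis by simp
qed

text \<open>Comparing the symmetric matrices of \<open>p\<close> and of its image cancels
  \<open>qcoef p i j\<close> and leaves the other three terms.\<close>

lemma invariant_qcoef_recurrence:
  fixes \<sigma> :: "'a::field_char_0 mpoly \<Rightarrow> 'a mpoly"
  assumes \<sigma>: "algebra_automorphism n \<sigma>" "\<sigma> (var 1) = var 1 - 1"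
      "\<forall>i\<in>{2..n}. \<sigma> (var i) = var i + var (i - 1)"
    and p: "p \<in> invariants n \<sigma> \<inter> polys_le n 2"
  shows "qcoef p i (Suc j) + qcoef p (Suc i) j + qcoef p (Suc i) (Suc j) = 0"
proof -
  let ?a = "qcoef p"
  let ?b = "\<lambda>i j. ?a i j + ?a (Suc i) j + ?a i (Suc j) + ?a (Suc i) (Suc j)"
  have "p \<in> polys n" "\<sigma> p = p" "p \<in> polys_le n 2"
    using p by (auto simp: invariants_def)
  have out: "?a i j = 0" if "n < i \<or> n < j" for i j
    using that qcoef_outside[OF \<open>p \<in> polys n\<close>] qcoef_sym[of p] by metis
  show ?thesis
  proof (cases "i \<le> n \<and> j \<le> n")
    case True
    have "p = qform n ?b"
      using automorphism_qform[OF \<sigma>, of ?a] out qform_qcoef[OF \<open>p \<in> polys_le n 2\<close>] \<open>\<sigma> p = p\<close> by simp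
    moreover have "qcoef (qform n ?b) i j = ?b i j"
      using True by (intro qcoef_qform) (auto simp: qcoef_sym add_ac)
    ultimately have "?a i j = ?b i j" by metis
    then show ?thesis by (simp add: add_ac)
  next
    case False
    \<comment> \<open>If \<open>i\<close> or \<open>j\<close> exceeds \<open>n\<close>, each of the
      three entries has an index beyond \<open>n\<close>.\<close>
    then show ?thesis using out by auto
  qed
qed

text \<open>The recurrence is linear, so it passes to the difference of the two matrices, whose
  relevant diagonal entries vanish.\<close>

lemma invariant_determined_by_diagonal:
  fixes \<sigma> :: "'a::field_char_0 mpoly \<Rightarrow> 'a mpoly"
  assumes \<sigma>: "algebra_automorphism n \<sigma>" "\<sigma> (var 1) = var 1 - 1"
      "\<forall>i\<in>{2..n}. \<sigma> (var i) = var i + var (i - 1)"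
    and p: "p \<in> invariants n \<sigma> \<inter> polys_le n 2" and q: "q \<in> invariants n \<sigma> \<inter> polys_le n 2"
    and diag: "\<And>k. 2 * k \<le> n \<Longrightarrow> qcoef p k k = qcoef q k k"
  shows "p = q"
proof -
  have "qcoef p i j - qcoef q i j = 0" for i j
  proof (rule antidiagonal_recurrence_zero[where a = "\<lambda>i j. qcoef p i j - qcoef q i j" and n = n])
    fix i j
    show "qcoef p i j - qcoef q i j = qcoef p j i - qcoef q j i"
      by (simp add: qcoef_sym)
    show "qcoef p i j - qcoef q i j = 0" if "n < i"
      using that p q qcoef_outside[of p n i j] qcoef_outside[of q n i j]
      by (simp add: invariants_def)
    have "qcoef p i (Suc j) + qcoef p (Suc i) j + qcoef p (Suc i) (Suc j) =
        qcoef q i (Suc j) + qcoef q (Suc i) j + qcoef q (Suc i) (Suc j)"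
      using invariant_qcoef_recurrence[OF \<sigma> p] invariant_qcoef_recurrence[OF \<sigma> q] by simp
    then show "(qcoef p i (Suc j) - qcoef q i (Suc j)) + (qcoef p (Suc i) j - qcoef q (Suc i) j) +
        (qcoef p (Suc i) (Suc j) - qcoef q (Suc i) (Suc j)) = 0"
      by (simp add: algebra_simps)
  qed (simp add: diag)
  then have "qcoef p = qcoef q"
    by (intro ext) simp
  then show ?thesis
    using qform_qcoef p q by (metis IntD2)
qed

section \<open>The invariants \<open>u\<^sub>k\<close>\<close>

text \<open>Here \<open>b\<close> may be any integer, but \<open>a = 0\<close> must be excluded: at
  \<open>a = b = 0\<close> the left side is 1 and the right side is 0.\<close>

lemma binom_pascal:
  "0 < a \<Longrightarrow> binom a b = binom (a - 1) (b - 1) + binom (a - 1) b"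
proof -
  assume a: "0 < a"
  show ?thesis
  proof (cases "1 \<le> b")
    case True
    obtain a' where "a = int (Suc a')" using a by (metis gr0_conv_Suc zero_less_imp_eq_int)
    moreover obtain b' where "b = int (Suc b')"
      using True by (metis gr0_conv_Suc int_one_le_iff_zero_less zero_less_imp_eq_int)
    ultimately show ?thesis
      by (auto simp: binom_def nat_add_distrib)
  next
    case False
    with a show ?thesis by (auto simp: binom_def)
  qed
qed

text \<open>Rows \<open>i\<close> and \<open>Suc i\<close> carry opposite signs, so the identity
  splits into Pascal's rule for each of the two binomial summands; \<open>Suc i < k\<close> makes
  the upper argument \<open>d\<close> of the second one positive.\<close>

lemma lambda_coeff_pascal:
  assumes "Suc i < k" "k \<le> j"
  shows "lambda_coeff k i (Suc j) + lambda_coeff k (Suc i) j + lambda_coeff k (Suc i) (Suc j) = 0"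
proof -
  define d e where "d = int k - int i - 1" and "e = int j - int k"
  have "binom (d + 1) (e + 1) = binom d e + binom d (e + 1)"
    "binom d e = binom (d - 1) (e - 1) + binom (d - 1) e"
    using binom_pascal[of "d + 1" "e + 1"] binom_pascal[of d e] assms(1) by (simp_all add: d_def)
  moreover have "k - i = Suc (k - Suc i)"
    using assms by simp
  moreover have "int k - int i = d + 1" "int k - int (Suc i) = d" "int j - int k = e"
      "int (Suc j) - int k = e + 1"
    by (simp_all add: d_def e_def)
  ultimately show ?thesis
    unfolding lambda_coeff_def by (simp add: algebra_simps)
qed

lemma lambda_coeff_diag: "i < k \<Longrightarrow> lambda_coeff k i k = (- 1) ^ (k - i)"
  by (simp add: lambda_coeff_def binom_def)

lemma lambda_coeff_zero: "i < k \<Longrightarrow> 2 * k - i < j \<Longrightarrow> lambda_coeff k i j = 0"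
  by (auto simp: lambda_coeff_def binom_def)

text \<open>No cancellation is possible inside the braces: the first binomial coefficient is
  positive and the second is nonnegative.\<close>

lemma lambda_coeff_nonzero:
  assumes "i < k" "k \<le> j" "j \<le> 2 * k - i"
  shows "lambda_coeff k i j \<noteq> 0"
proof -
  have "binom (int k - int i) (int j - int k) > 0"
    using assms by (auto simp: binom_def)
  moreover have "binom (int k - int i - 1) (int j - int k - 1) \<ge> 0"
    by (simp add: binom_def)
  ultimately show ?thesis
    by (simp add: lambda_coeff_def)
qed

text \<open>The linear part of \<open>u k\<close> is thus row 0 of the quadratic part, the minus
  sign coming from \<open>hvar 0 = - 1\<close>.\<close>

lemma mu_coeff_eq: "1 \<le> k \<Longrightarrow> mu_coeff k i = - lambda_coeff k 0 i"
  by (cases k) (simp_all add: mu_coeff_def lambda_coeff_def)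

text \<open>The symmetric matrix of \<open>u k\<close>: every mixed coefficient is halved between
  its two positions. For \<open>k = 0\<close> only the entry \<open>(0, 0)\<close> remains, giving
  the form 1.\<close>

definition umat :: "nat \<Rightarrow> nat \<Rightarrow> nat \<Rightarrow> 'a::field" where
  "umat k i j = (if i = k \<and> j = k then 1
     else if i < k \<and> k \<le> j then of_int (lambda_coeff k i j) / 2
     else if j < k \<and> k \<le> i then of_int (lambda_coeff k j i) / 2 else 0)"

lemma umat_sym: "umat k i j = umat k j i"
  by (auto simp: umat_def)

lemma umat_outside: "2 * k \<le> n \<Longrightarrow> n < i \<or> n < j \<Longrightarrow> umat k i j = 0"
  by (auto simp: umat_def lambda_coeff_zero)

lemma umat_recurrence:
  "umat k i (Suc j) + umat k (Suc i) j + umat k (Suc i) (Suc j) = (0::'a::field_char_0)"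
proof (induction i j rule: linorder_wlog)
  case (le i j)
  have c: "lambda_coeff k i (Suc k) = - 2" "lambda_coeff k i k = - 1" if "k = Suc i"
    using that by (simp_all add: lambda_coeff_def binom_def)
  \<comment> \<open>The cases locate the three entries relative to the corner \<open>(k, k)\<close>.
    Pascal's rule serves the inside of the block; next to the corner the sums are -1/2 - 1/2 + 1 and
    -1 + 1 + 0.\<close>
  consider "Suc j < k" | "Suc j = k" "Suc i < k" | "Suc j = k" "Suc i = k"
    | "k \<le> j" "Suc i < k" | "k < j" "Suc i = k" | "k = j" "Suc i = k" | "k \<le> j" "k \<le> i"
    using le by linarith
  then show ?case
  proof cases
    case 2
    then have "k - i = Suc (k - Suc i)" by simp
    with 2 show ?thesis by (simp add: umat_def lambda_coeff_diag)
  next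
    case 3
    then show ?thesis using c by (auto simp: umat_def)
  next
    case 4
    have "(of_int (lambda_coeff k i (Suc j) + lambda_coeff k (Suc i) j +
        lambda_coeff k (Suc i) (Suc j)) :: 'a) = 0"
      using lambda_coeff_pascal 4 by simp
    with 4 show ?thesis
      by (simp add: umat_def flip: add_divide_distrib)
  next
    case 5
    then show ?thesis by (simp add: umat_def lambda_coeff_zero)
  next
    case 6
    then show ?thesis using c by (simp add: umat_def)
  qed (use le in \<open>auto simp: umat_def\<close>)
next
  case (sym i j)
  then show ?case
    by (simp add: umat_sym add_ac)
qed

lemma qform_umat:
  assumes "2 * k \<le> n"
  shows "qform n (umat k) = (u k :: 'a::field_char_0 mpoly)"
proof -
  let ?h = "\<lambda>i j. hvar i * hvar j :: 'a mpoly"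
  let ?A = "\<lambda>i j. if i < k \<and> k \<le> j then smult (of_int (lambda_coeff k i j) / 2) (?h i j) else 0"
  have half: "smult (c / 2) p + smult (c / 2) p = smult c p" for c :: 'a and p
  proof -
    have "c / 2 + c / 2 = c" by simp
    then show ?thesis by (simp only: mpoly.scale_left_distrib[symmetric])
  qed
  \<comment> \<open>The form splits into the corner, the block above it and the transposed block;
    the two blocks have equal sums, so the halves recombine.\<close>
  have "qform n (umat k) =
      (\<Sum>i\<le>n. \<Sum>j\<le>n. (if i = k then if j = k then ?h i j else 0 else 0) + ?A i j + ?A j i)"
    unfolding qform_def by (intro sum.cong refl) (auto simp: umat_def mult.commute)
  also have "\<dots> = (\<Sum>i\<le>n. \<Sum>j\<le>n. if i = k then if j = k then ?h i j else 0 else 0) +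
      (\<Sum>i\<le>n. \<Sum>j\<le>n. ?A i j) + (\<Sum>i\<le>n. \<Sum>j\<le>n. ?A j i)"
    by (simp add: sum.distrib)
  also have "(\<Sum>i\<le>n. \<Sum>j\<le>n. ?A j i) = (\<Sum>i\<le>n. \<Sum>j\<le>n. ?A i j)"
    by (rule sum.swap)
  also have "(\<Sum>i\<le>n. \<Sum>j\<le>n. if i = k then if j = k then ?h i j else 0 else 0) = ?h k k"
  proof -
    have "(\<Sum>i\<le>n. \<Sum>j\<le>n. if i = k then if j = k then ?h i j else 0 else 0) =
        (\<Sum>i\<le>n. if i = k then \<Sum>j\<le>n. if j = k then ?h i j else 0 else 0)"
      by (intro sum.cong) auto
    then show ?thesis using assms by simp
  qed
  finally have "qform n (umat k) = ?h k k + ((\<Sum>i\<le>n. \<Sum>j\<le>n. ?A i j) + (\<Sum>i\<le>n. \<Sum>j\<le>n. ?A i j))"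
    by (simp add: add_ac)
  also have "(\<Sum>i\<le>n. \<Sum>j\<le>n. ?A i j) + (\<Sum>i\<le>n. \<Sum>j\<le>n. ?A i j) =
      (\<Sum>i\<le>n. \<Sum>j\<le>n. if i < k \<and> k \<le> j then smult (of_int (lambda_coeff k i j)) (?h i j) else 0)"
    unfolding sum.distrib[symmetric]
    by (intro sum.cong refl) (auto simp only: half if_True if_False add_0 split: if_split)
  \<comment> \<open>Coefficients beyond \<open>2 * k - i\<close> vanish, and
    \<open>2 * k \<le> n\<close> keeps the shorter ranges within \<open>n\<close>.\<close>
  also have "\<dots> = (\<Sum>i<k. \<Sum>j=k..2*k-i. smult (of_int (lambda_coeff k i j)) (?h i j))"
  proof -
    have "(\<Sum>j\<le>n. if i < k \<and> k \<le> j then smult (of_int (lambda_coeff k i j)) (?h i j) else 0) =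
        (if i < k then \<Sum>j=k..2*k-i. smult (of_int (lambda_coeff k i j)) (?h i j) else 0)" for i
    proof (cases "i < k")
      case True
      then show ?thesis
        using assms by (auto intro!: sum.mono_neutral_cong_right simp: lambda_coeff_zero)
    qed simp
    then show ?thesis
      using assms by (auto intro!: sum.mono_neutral_cong_right split: if_splits)
  qed
  also have "?h k k + \<dots> = u k"
  proof (cases "k = 0")
    case True
    then show ?thesis by (simp add: u_def hvar_def)
  next
    case False
    \<comment> \<open>Row 0 is split off, since it becomes the linear part with the coefficients
      \<open>mu_coeff\<close>.\<close>
    then have "{..<k} = insert 0 {1..k - 1}" by auto
    then have "(\<Sum>i<k. \<Sum>j=k..2*k-i. smult (of_int (lambda_coeff k i j)) (?h i j)) =
        (\<Sum>i=1..k-1. \<Sum>j=k..2*k-i. smult (of_int (lambda_coeff k i j)) (?h i j)) +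
        (\<Sum>j=k..2*k. smult (of_int (lambda_coeff k 0 j)) (?h 0 j))"
      by (simp add: add.commute)
    also have "(\<Sum>j=k..2*k. smult (of_int (lambda_coeff k 0 j)) (?h 0 j)) =
        (\<Sum>j=k..2*k. smult (of_int (mu_coeff k j)) (var j))"
      using False by (intro sum.cong) (auto simp: mu_coeff_eq hvar_def)
    also have "(\<Sum>i=1..k-1. \<Sum>j=k..2*k-i. smult (of_int (lambda_coeff k i j)) (?h i j)) =
        (\<Sum>i=1..k-1. \<Sum>j=k..2*k-i. smult (of_int (lambda_coeff k i j)) (var i * var j))"
      using False by (intro sum.cong) (auto simp: hvar_def)
    finally show ?thesis
      using False by (simp add: u_def hvar_def power2_eq_square add_ac)
  qed
  finally show ?thesis .
qed

text \<open>The functionals \<open>qcoef p l l\<close> are dual to the \<open>u k\<close>; this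
  yields both their independence and the coefficients of an expansion.\<close>

lemma qcoef_u_diag:
  assumes "2 * k \<le> n" "2 * l \<le> n"
  shows "qcoef (u k :: 'a::field_char_0 mpoly) l l = (if l = k then 1 else 0)"
proof -
  have "qcoef (qform n (umat k)) l l = (umat k l l :: 'a)"
    using assms by (intro qcoef_qform umat_sym) auto
  then show ?thesis
    using assms by (auto simp: qform_umat umat_def)
qed

text \<open>By \<open>umat_recurrence\<close>, the three terms that the automorphism adds to each
  matrix entry sum to zero.\<close>

lemma u_invariant:
  fixes \<sigma> :: "'a::field_char_0 mpoly \<Rightarrow> 'a mpoly"
  assumes \<sigma>: "algebra_automorphism n \<sigma>" "\<sigma> (var 1) = var 1 - 1"
      "\<forall>i\<in>{2..n}. \<sigma> (var i) = var i + var (i - 1)"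
    and "2 * k \<le> n"
  shows "u k \<in> invariants n \<sigma> \<inter> polys_le n 2"
proof -
  have "umat k i j + umat k (Suc i) j + umat k i (Suc j) + umat k (Suc i) (Suc j) =
      (umat k i j :: 'a)" for i j
    using umat_recurrence[of k i j, where 'a = 'a] by (simp add: algebra_simps)
  then have "\<sigma> (qform n (umat k)) = qform n (umat k)"
    using automorphism_qform[OF \<sigma> umat_outside[OF assms(4)]] by (simp only:)
  then show ?thesis
    using qform_polys_le[of n "umat k :: nat \<Rightarrow> nat \<Rightarrow> 'a"] qform_umat[OF assms(4), where 'a = 'a]
    by (auto simp: invariants_def polys_le_def)
qed

section \<open>The basis of the space of invariants\<close>

lemma subspace_invariants:
  fixes \<sigma> :: "'a::field mpoly \<Rightarrow> 'a mpoly"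
  assumes \<sigma>: "algebra_automorphism n \<sigma>"
  shows "mpoly.subspace (invariants n \<sigma> \<inter> polys_le n d)"
proof (rule mpoly.subspaceI)
  have \<sigma>c: "\<sigma> (const c) = const c" for c
    using \<sigma> by (simp add: algebra_automorphism_def)
  from this[of 0] show "0 \<in> invariants n \<sigma> \<inter> polys_le n d"
    by (simp add: invariants_def polys_le_def polys_closed)
  fix p q and c :: 'a
  assume p: "p \<in> invariants n \<sigma> \<inter> polys_le n d"
  show "p + q \<in> invariants n \<sigma> \<inter> polys_le n d" if "q \<in> invariants n \<sigma> \<inter> polys_le n d"
    using p that \<sigma> keys_add[of p q]
    by (auto simp: invariants_def polys_le_def algebra_automorphism_def polys_closed)
  have "Poly_Mapping.keys (smult c p) \<subseteq> Poly_Mapping.keys p"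
    by (auto simp: in_keys_iff lookup_smult)
  moreover have "smult c p \<in> polys n"
    using p by (auto simp: invariants_def intro: smult_polys)
  moreover have "\<sigma> (smult c p) = smult c p"
    using p \<sigma> \<sigma>c polys_closed(4)[of c n]
    by (simp add: smult_def invariants_def algebra_automorphism_def)
  ultimately show "smult c p \<in> invariants n \<sigma> \<inter> polys_le n d"
    using p by (auto simp: invariants_def polys_le_def)
qed

text \<open>Both sides are invariants with the same diagonal, by duality, so uniqueness
  applies.\<close>

lemma invariant_expansion:
  fixes \<sigma> :: "'a::field_char_0 mpoly \<Rightarrow> 'a mpoly"
  assumes \<sigma>: "algebra_automorphism n \<sigma>" "\<sigma> (var 1) = var 1 - 1"
      "\<forall>i\<in>{2..n}. \<sigma> (var i) = var i + var (i - 1)"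
    and p: "p \<in> invariants n \<sigma> \<inter> polys_le n 2"
  shows "p = (\<Sum>k\<in>{0..n div 2}. smult (qcoef p k k) (u k))"
proof (rule invariant_determined_by_diagonal[OF \<sigma> p])
  show "(\<Sum>k\<in>{0..n div 2}. smult (qcoef p k k) (u k)) \<in> invariants n \<sigma> \<inter> polys_le n 2"
    by (intro mpoly.subspace_sum mpoly.subspace_scale subspace_invariants[OF \<sigma>(1)]
        u_invariant[OF \<sigma>]) auto
  fix l
  assume l: "2 * l \<le> n"
  have "qcoef (\<Sum>k\<in>{0..n div 2}. smult (qcoef p k k) (u k)) l l =
      (\<Sum>k\<in>{0..n div 2}. if l = k then qcoef p k k else 0)"
    unfolding qcoef_sum qcoef_smult
    by (intro sum.cong refl) (use l in \<open>auto simp: qcoef_u_diag[where n = n]\<close>)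
  then show "qcoef p l l = qcoef (\<Sum>k\<in>{0..n div 2}. smult (qcoef p k k) (u k)) l l"
    using l by auto
qed

lemma u_inj_independent:
  fixes n :: nat
  defines "U \<equiv> (u :: nat \<Rightarrow> 'a::field_char_0 mpoly)"
  shows "inj_on U {0..n div 2}" "mpoly.independent (U ` {0..n div 2})"
proof -
  have diag: "qcoef (U k) l l = (if l = k then 1 else 0)"
    if "k \<in> {0..n div 2}" "l \<in> {0..n div 2}" for k l
    unfolding U_def by (rule qcoef_u_diag[of _ n]) (use that in auto)
  show inj: "inj_on U {0..n div 2}"
  proof (rule inj_onI)
    fix k l
    assume "k \<in> {0..n div 2}" "l \<in> {0..n div 2}" "U k = U l"
    then show "k = l"
      using diag[of k k] diag[of l k] by (auto split: if_splits)
  qed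
  show "mpoly.independent (U ` {0..n div 2})"
  proof (rule mpoly.independent_if_scalars_zero)
    fix f v
    assume s: "(\<Sum>x\<in>U ` {0..n div 2}. smult (f x) x) = 0" and "v \<in> U ` {0..n div 2}"
    then obtain l where l: "v = U l" "l \<in> {0..n div 2}" by blast
    have "0 = qcoef (\<Sum>k\<in>{0..n div 2}. smult (f (U k)) (U k)) l l"
      using s by (simp add: sum.reindex[OF inj])
    also have "\<dots> = (\<Sum>k\<in>{0..n div 2}. if l = k then f (U k) else 0)"
      unfolding qcoef_sum qcoef_smult
      by (intro sum.cong refl) (use l diag in auto)
    also have "\<dots> = f v"
      using l by simp
    finally show "f v = 0" by simp
  qed simp
qed

theorem theorem1p2:
  fixes n m :: nat
    and \<sigma> :: "'a::field_char_0 mpoly \<Rightarrow> 'a mpoly"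
  assumes "n \<ge> 2"
    and "algebra_automorphism n \<sigma>"
    and "\<sigma> (var 1) = var 1 - 1"
    and "\<forall>i\<in>{2..n}. \<sigma> (var i) = var i + var (i - 1)"
    and "m = n div 2"
  shows "inj_on (u :: nat \<Rightarrow> 'a mpoly) {0..m} \<and>
         mpoly.independent ((u :: nat \<Rightarrow> 'a mpoly) ` {0..m}) \<and>
         mpoly.span ((u :: nat \<Rightarrow> 'a mpoly) ` {0..m}) = invariants n \<sigma> \<inter> polys_le n 2 \<and>
         mpoly.dim (invariants n \<sigma> \<inter> polys_le n 2) = m + 1 \<and>
         invariants n \<sigma> \<inter> polys_le n 1 = range const \<and>
         (\<forall>k\<in>{1..m}. (\<forall>i\<in>{1..k-1}. \<forall>j\<in>{k..2*k-i}. (of_int (lambda_coeff k i j) :: 'a) \<noteq> 0) \<and>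
                      (\<forall>i\<in>{k..2*k}. (of_int (mu_coeff k i) :: 'a) \<noteq> 0))"
proof -
  let ?U = "u :: nat \<Rightarrow> 'a mpoly" and ?V = "invariants n \<sigma> \<inter> polys_le n 2"
  note \<sigma> = assms(2-4)
  have inj: "inj_on ?U {0..m}" and ind: "mpoly.independent (?U ` {0..m})"
    using u_inj_independent[of n] assms(5) by auto
  have span: "mpoly.span (?U ` {0..m}) = ?V"
  proof
    show "mpoly.span (?U ` {0..m}) \<subseteq> ?V"
      using u_invariant[OF \<sigma>] subspace_invariants[OF \<sigma>(1)] assms(5)
      by (intro mpoly.span_minimal) auto
    show "?V \<subseteq> mpoly.span (?U ` {0..m})"
    proof
      fix p
      assume p: "p \<in> ?V"
      show "p \<in> mpoly.span (?U ` {0..m})"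
        by (subst invariant_expansion[OF \<sigma> p])
           (auto intro!: mpoly.span_sum intro: mpoly.span_scale mpoly.span_base simp: assms(5))
    qed
  qed
  have dim: "mpoly.dim ?V = m + 1"
    using mpoly.dim_span_eq_card_independent[OF ind] span inj by (simp add: card_image)
  have linear: "invariants n \<sigma> \<inter> polys_le n 1 = range const"
  proof
    show "range const \<subseteq> invariants n \<sigma> \<inter> polys_le n 1"
    proof -
      have "mon_degree r = 0" if "r \<in> Poly_Mapping.keys (const c :: 'a mpoly)" for r c
        using that by (auto simp: const_def mon_degree_def split: if_splits)
      then show ?thesis
        using \<sigma>(1) polys_closed(4)
        by (auto simp: invariants_def polys_le_def algebra_automorphism_def)
    qed
    show "invariants n \<sigma> \<inter> polys_le n 1 \<subseteq> range const"
    proof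
      fix p
      assume p: "p \<in> invariants n \<sigma> \<inter> polys_le n 1"
      then have "p \<in> ?V"
        by (force simp: polys_le_def)
      \<comment> \<open>These entries are the coefficients of squares, which have degree 2; only the
        multiple of \<open>u 0 = 1\<close> survives in the expansion.\<close>
      have "qcoef p k k = 0" if "k \<noteq> 0" for k
      proof -
        have "mon_degree (hmon k + hmon k) = 2"
          using that by (simp add: mon_degree_add mon_degree_hmon)
        then have "hmon k + hmon k \<notin> Poly_Mapping.keys p"
          using p by (force simp: polys_le_def)
        then show ?thesis by (simp add: qcoef_def in_keys_iff)
      qed
      then have "(\<Sum>k\<in>{0..n div 2}. smult (qcoef p k k) (?U k)) = smult (qcoef p 0 0) (u 0)"
        by (subst sum.remove[of _ 0]) (auto intro!: sum.neutral)
      then have "p = const (qcoef p 0 0)"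
        using invariant_expansion[OF \<sigma> \<open>p \<in> ?V\<close>] by (simp add: u_def smult_def)
      then show "p \<in> range const" by blast
    qed
  qed
  \<comment> \<open>Nonvanishing passes from the integers to the field in characteristic zero; for
    \<open>mu_coeff\<close> it is the row \<open>i = 0\<close> of
    \<open>lambda_coeff_nonzero\<close>.\<close>
  show ?thesis
    using inj ind span dim linear by (auto simp: mu_coeff_eq lambda_coeff_nonzero)
qed

end
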